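(* Let $\mathbb{F}\in\{\mathbb{R},\mathbb{C}\}$, with $\beta=1$ if $\mathbb{F}=\mathbb{R}$ and $\beta=2$ if $\mathbb{F}=\mathbb{C}$. Let $A\in\mathbb{F}^{m\times n}$ be an input matrix, let $\Theta\in\mathbb{F}^{q\times m}$ be a standard normal matrix, and let $W=\Theta A\in\mathbb{F}^{q\times n}$. Let $\hat A_{\rm out}\in\mathbb{F}^{m\times n}$ be an approximation of $A$, computed via any method, that does not depend on the matrices $\Theta, W$. Define $$\mathrm{err}_2^2(\hat A_{\rm out})=\frac{1}{\beta q}\,\|W-\Theta\hat A_{\rm out}\|_2^2=\frac{1}{\beta q}\,\|\Theta(A-\hat A_{\rm out})\|_2^2.$$ Then $$\mathbb{P}_\Theta\left\{\mathrm{err}_2^2(\hat A_{\rm out})\ge(1+\varepsilon)\,\|A-\hat A_{\rm out}\|_2^2\right\}\le\left[\frac{e^{\varepsilon}}{1+\varepsilon}\right]^{-\beta q/2}\quad\text{for }\varepsilon>0.$$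
   Context: $\|\cdot\|_2$ is the Schatten 2-norm (Frobenius norm). A standard normal matrix over $\mathbb{R}$ has independent $N(0,1)$ entries; over $\mathbb{C}$ its entries are independent and of the form $g_1+\mathrm{i}g_2$ with $g_1,g_2$ independent real $N(0,1)$ variables. The matrices $A$ and $\hat A_{\rm out}$ are treated as fixed with respect to $\Theta$; $\mathbb{P}_\Theta$ is probability over $\Theta$.
   Formalization: The formal theorem assumes that A differs from its approximation Â_out; if they are equal, the error is 0, the event 0 ≥ 0 has probability 1, and the right-hand side is below 1, so the stated bound fails. *)

theory Defs
  imports "HOL-Probability.Probability"
begin

definition frobenius_norm :: "'f::real_normed_vector^'n^'m \<Rightarrow> real" where
  "frobenius_norm A = sqrt (\<Sum>i\<in>UNIV. \<Sum>j\<in>UNIV. (norm (A $ i $ j))\<^sup>2)"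

lemma frobenius_norm_eq_norm: "frobenius_norm A = norm A"
  by (simp add: frobenius_norm_def norm_vec_def L2_set_def sum_nonneg)

definition std_normal_real :: "'a measure \<Rightarrow> ('a \<Rightarrow> real) \<Rightarrow> bool" where
  "std_normal_real M X \<longleftrightarrow> distributed M lborel X std_normal_density"

text \<open>No factor \<open>1 / sqrt 2\<close>: the real and the imaginary part both have variance 1, so
  a standard normal complex variable has \<open>E |z|\<^sup>2 = 2\<close>.\<close>

definition std_normal_complex :: "'a measure \<Rightarrow> ('a \<Rightarrow> complex) \<Rightarrow> bool" where
  "std_normal_complex M Z \<longleftrightarrow>
     (\<exists>g1 g2. std_normal_real M g1 \<and> std_normal_real M g2 \<and>
       prob_space.indep_var M borel g1 borel g2 \<and>
       (\<forall>\<omega>\<in>space M. Z \<omega> = complex_of_real (g1 \<omega>) + \<i> * complex_of_real (g2 \<omega>)))"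

definition indep_entries ::
    "'a measure \<Rightarrow> ('a \<Rightarrow> 'f::topological_space^'m^'q) \<Rightarrow> bool" where
  "indep_entries M \<Theta> \<longleftrightarrow>
     prob_space.indep_vars M (\<lambda>_. borel) (\<lambda>(i, j) \<omega>. \<Theta> \<omega> $ i $ j) UNIV"

definition std_normal_matrix_real :: "'a measure \<Rightarrow> ('a \<Rightarrow> real^'m^'q) \<Rightarrow> bool" where
  "std_normal_matrix_real M \<Theta> \<longleftrightarrow>
     indep_entries M \<Theta> \<and> (\<forall>i j. std_normal_real M (\<lambda>\<omega>. \<Theta> \<omega> $ i $ j))"

definition std_normal_matrix_complex :: "'a measure \<Rightarrow> ('a \<Rightarrow> complex^'m^'q) \<Rightarrow> bool" where
  "std_normal_matrix_complex M \<Theta> \<longleftrightarrow>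
     indep_entries M \<Theta> \<and> (\<forall>i j. std_normal_complex M (\<lambda>\<omega>. \<Theta> \<omega> $ i $ j))"

text \<open>\<open>\<beta>\<close> is the real dimension of the scalar field. \<open>A\<close> itself is not an argument: it enters only
  through the sketch \<open>W = \<Theta> A\<close>.\<close>

definition err_sq ::
    "real \<Rightarrow> 'f::real_normed_field^'n^'q \<Rightarrow> 'f^'m^'q \<Rightarrow> 'f^'n^'m \<Rightarrow> real" where
  "err_sq \<beta> W \<Theta> B = 1 / (\<beta> * real CARD('q)) * (frobenius_norm (W - \<Theta> ** B))\<^sup>2"

lemma err_sq_sketch:
  fixes A B :: "'f::real_normed_field^'n^'m" and \<Theta> :: "'f^'m^'q"
  shows "err_sq \<beta> (\<Theta> ** A) \<Theta> B =
    1 / (\<beta> * real CARD('q)) * (frobenius_norm (\<Theta> ** (A - B)))\<^sup>2"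
proof -
  have "\<Theta> ** A - \<Theta> ** B = \<Theta> ** (A - B)"
    by (simp add: vec_eq_iff matrix_matrix_mult_def sum_subtractf right_diff_distrib)
  then show ?thesis
    by (simp add: err_sq_def)
qed

end

theory Submission
  imports Defs
begin

text \<open>Write \<open>D = A - Aout\<close>, with columns \<open>d\<^sub>k\<close>. As \<open>exp\<close> is convex, Jensen's inequality with weights
  \<open>\<parallel>d\<^sub>k\<parallel>\<^sup>2 / \<parallel>D\<parallel>\<^sup>2\<close> bounds the moment generating function of \<open>\<parallel>\<Theta> D\<parallel>\<^sup>2 / \<parallel>D\<parallel>\<^sup>2\<close> by that of
  \<open>\<parallel>\<Theta> u\<parallel>\<^sup>2\<close> for unit vectors \<open>u\<close>; no diagonalisation of \<open>D\<close> is needed. For a unit vector,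
  \<open>exp (s \<parallel>w\<parallel>\<^sup>2) = E\<^sub>h exp (sqrt (2 s) \<langle>h, w\<rangle>)\<close> for a standard normal vector \<open>h\<close>; taking for \<open>h\<close> a
  column of an independent copy of \<open>\<Theta>\<close> and exchanging the expectations gives
  \<open>E exp (s \<parallel>\<Theta> u\<parallel>\<^sup>2) = E exp (s \<parallel>h\<parallel>\<^sup>2) = (1 - 2 s) powr (- \<beta> q / 2)\<close>. The bound is Markov's
  inequality at \<open>s = \<epsilon> / (2 (1 + \<epsilon>))\<close>.\<close>

section \<open>Real normal variables\<close>

lemma nn_integral_normal_density:
  assumes "\<sigma> > 0"
  shows "(\<integral>\<^sup>+x. ennreal (normal_density \<mu> \<sigma> x) \<partial>lborel) = 1"
  using prob_space.emeasure_space_1[OF prob_space_normal_density[OF assms, of \<mu>]]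
  by (simp add: emeasure_density)

lemma std_normal_nn_integral:
  assumes "std_normal_real M X" "f \<in> borel_measurable borel"
  shows "(\<integral>\<^sup>+\<omega>. f (X \<omega>) \<partial>M) = (\<integral>\<^sup>+x. ennreal (std_normal_density x) * f x \<partial>lborel)"
  using assms unfolding std_normal_real_def
  by (subst distributed_nn_integral[of M lborel X]) auto

lemma std_normal_real_mgf:
  assumes "std_normal_real M X"
  shows "(\<integral>\<^sup>+\<omega>. ennreal (exp (a * X \<omega>)) \<partial>M) = ennreal (exp (a\<^sup>2 / 2))"
proof -
  \<comment> \<open>Completing the square: tilting the standard normal density by
    \<open>exp (a * x)\<close> shifts its mean to \<open>a\<close>, at the cost of a constant
    factor.\<close>
  have *: "std_normal_density x * exp (a * x) = exp (a\<^sup>2 / 2) * normal_density a 1 x" for x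
  proof -
    have "- x\<^sup>2 / 2 + a * x = a\<^sup>2 / 2 + - (x - a)\<^sup>2 / 2"
      by (simp add: power2_eq_square field_simps)
    then have "exp (- x\<^sup>2 / 2) * exp (a * x) = exp (a\<^sup>2 / 2) * exp (- (x - a)\<^sup>2 / 2)"
      by (simp only: exp_add[symmetric])
    then show ?thesis
      by (simp add: normal_density_def)
  qed
  have "(\<integral>\<^sup>+\<omega>. ennreal (exp (a * X \<omega>)) \<partial>M) =
      (\<integral>\<^sup>+x. ennreal (std_normal_density x) * ennreal (exp (a * x)) \<partial>lborel)"
    by (rule std_normal_nn_integral[OF assms]) measurable
  also have "\<dots> = (\<integral>\<^sup>+x. ennreal (exp (a\<^sup>2 / 2)) * ennreal (normal_density a 1 x) \<partial>lborel)"
    by (simp only: ennreal_mult'[symmetric] normal_density_nonneg exp_ge_zero *)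
  also have "\<dots> = ennreal (exp (a\<^sup>2 / 2))"
    by (simp add: nn_integral_cmult nn_integral_normal_density)
  finally show ?thesis .
qed

lemma std_normal_real_mgf_square:
  assumes "std_normal_real M X" "s < 1 / 2"
  shows "(\<integral>\<^sup>+\<omega>. ennreal (exp (s * (X \<omega>)\<^sup>2)) \<partial>M) = ennreal ((1 - 2 * s) powr (- 1 / 2))"
proof -
  \<comment> \<open>Tilting by \<open>exp (s * x\<^sup>2)\<close> gives a multiple of a centred
    normal density with variance \<open>1 / (1 - 2 * s)\<close>. The multiple is the standard
    deviation \<open>\<sigma>\<close>, which is therefore the value of the integral;
    \<open>s < 1 / 2\<close> keeps the variance positive and finite.\<close>
  define \<sigma> where "\<sigma> = (1 - 2 * s) powr (- 1 / 2)"
  have \<sigma>: "\<sigma> > 0" "\<sigma>\<^sup>2 = 1 / (1 - 2 * s)"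
  proof -
    show "\<sigma> > 0"
      using assms(2) by (simp add: \<sigma>_def)
    have "\<sigma>\<^sup>2 = (1 - 2 * s) powr (- 1)"
      by (simp add: \<sigma>_def power2_eq_square powr_add[symmetric])
    then show "\<sigma>\<^sup>2 = 1 / (1 - 2 * s)"
      using assms(2) by (simp add: powr_minus_divide)
  qed
  have *: "std_normal_density x * exp (s * x\<^sup>2) = \<sigma> * normal_density 0 \<sigma> x" for x
  proof -
    have "- x\<^sup>2 / 2 + s * x\<^sup>2 = - x\<^sup>2 / (2 * \<sigma>\<^sup>2)"
      using assms(2) by (simp add: \<sigma>(2) field_simps)
    then have "exp (- x\<^sup>2 / 2) * exp (s * x\<^sup>2) = exp (- x\<^sup>2 / (2 * \<sigma>\<^sup>2))"
      by (simp only: exp_add[symmetric])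
    moreover have "sqrt (2 * pi * \<sigma>\<^sup>2) = sqrt (2 * pi) * \<sigma>"
      using \<sigma>(1) by (simp add: real_sqrt_mult)
    ultimately show ?thesis
      using \<sigma>(1) by (simp add: normal_density_def)
  qed
  have "(\<integral>\<^sup>+\<omega>. ennreal (exp (s * (X \<omega>)\<^sup>2)) \<partial>M) =
      (\<integral>\<^sup>+x. ennreal (std_normal_density x) * ennreal (exp (s * x\<^sup>2)) \<partial>lborel)"
    by (rule std_normal_nn_integral[OF assms(1)]) measurable
  also have "\<dots> = (\<integral>\<^sup>+x. ennreal \<sigma> * ennreal (normal_density 0 \<sigma> x) \<partial>lborel)"
    using \<sigma>(1)[THEN less_imp_le] by (simp only: ennreal_mult'[symmetric] normal_density_nonneg *)
  also have "\<dots> = ennreal \<sigma>"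
    using \<sigma>(1) by (simp add: nn_integral_cmult nn_integral_normal_density)
  finally show ?thesis
    by (simp add: \<sigma>_def)
qed

section \<open>Independent pairs and complex normal variables\<close>

lemma (in prob_space) indep_var_nn_integral_mult:
  fixes X Y :: "'a \<Rightarrow> real" and f g :: "real \<Rightarrow> ennreal"
  assumes indep: "indep_var borel X borel Y"
    and f: "f \<in> borel_measurable borel" and g: "g \<in> borel_measurable borel"
  shows "(\<integral>\<^sup>+\<omega>. f (X \<omega>) * g (Y \<omega>) \<partial>M) = (\<integral>\<^sup>+\<omega>. f (X \<omega>) \<partial>M) * (\<integral>\<^sup>+\<omega>. g (Y \<omega>) \<partial>M)"
proof -
  \<comment> \<open>\<open>indep_var\<close> is by definition \<open>indep_vars\<close> over
    \<open>bool\<close>, so the product rule for finite families applies.\<close>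
  have "indep_vars (\<lambda>_. borel) (\<lambda>b \<omega>. case_bool f g b (case_bool X Y b \<omega>)) UNIV"
    using f g
    by (intro indep_vars_compose2[OF indep[unfolded indep_var_def]]) (simp split: bool.split)
  then have "(\<integral>\<^sup>+\<omega>. (\<Prod>b\<in>UNIV. case_bool f g b (case_bool X Y b \<omega>)) \<partial>M) =
      (\<Prod>b\<in>UNIV. \<integral>\<^sup>+\<omega>. case_bool f g b (case_bool X Y b \<omega>) \<partial>M)"
    by (intro indep_vars_nn_integral) auto
  then show ?thesis
    by (simp add: UNIV_bool mult.commute)
qed

lemma std_normal_complexE:
  assumes "std_normal_complex M Z"
  obtains g1 g2 where "std_normal_real M g1" "std_normal_real M g2"
    "prob_space.indep_var M borel g1 borel g2"
    "\<And>\<omega>. \<omega> \<in> space M \<Longrightarrow> Re (Z \<omega>) = g1 \<omega>" "\<And>\<omega>. \<omega> \<in> space M \<Longrightarrow> Im (Z \<omega>) = g2 \<omega>"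
  using assms unfolding std_normal_complex_def by auto

text \<open>For the real inner product on the complex plane, the adjoint of multiplication by
  \<open>u\<close> is multiplication by \<open>cnj u\<close>. This is the form in which the argument
  for general scalars uses conjugation.\<close>

lemma inner_mult_complex: "x \<bullet> (y * u) = (x * cnj u) \<bullet> y" for x y u :: complex
  by (simp add: inner_complex_def algebra_simps)

text \<open>The real inner product with \<open>a\<close> is \<open>Re a * g1 + Im a * g2\<close>, so
  independence splits the integral into two real ones. As both parts have variance 1, the formula
  agrees with the real one, and a single argument can serve both fields.\<close>

lemma (in prob_space) std_normal_complex_mgf:
  assumes "std_normal_complex M Z"
  shows "(\<integral>\<^sup>+\<omega>. ennreal (exp (a \<bullet> Z \<omega>)) \<partial>M) = ennreal (exp ((norm a)\<^sup>2 / 2))"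
proof -
  obtain g1 g2 where g: "std_normal_real M g1" "std_normal_real M g2"
    "indep_var borel g1 borel g2"
    and Z: "\<And>\<omega>. \<omega> \<in> space M \<Longrightarrow> Re (Z \<omega>) = g1 \<omega>" "\<And>\<omega>. \<omega> \<in> space M \<Longrightarrow> Im (Z \<omega>) = g2 \<omega>"
    using assms by (rule std_normal_complexE) blast
  have "(\<integral>\<^sup>+\<omega>. ennreal (exp (a \<bullet> Z \<omega>)) \<partial>M) =
      (\<integral>\<^sup>+\<omega>. ennreal (exp (Re a * g1 \<omega>)) * ennreal (exp (Im a * g2 \<omega>)) \<partial>M)"
    by (intro nn_integral_cong) (simp add: inner_complex_def Z exp_add ennreal_mult')
  also have "\<dots> = (\<integral>\<^sup>+\<omega>. ennreal (exp (Re a * g1 \<omega>)) \<partial>M) * (\<integral>\<^sup>+\<omega>. ennreal (exp (Im a * g2 \<omega>)) \<partial>M)"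
    by (rule indep_var_nn_integral_mult[OF g(3)]) measurable
  also have "\<dots> = ennreal (exp ((norm a)\<^sup>2 / 2))"
    by (simp add: std_normal_real_mgf g cmod_power2 add_divide_distrib exp_add ennreal_mult')
  finally show ?thesis .
qed

text \<open>The squared modulus is the sum of two independent squares, each contributing the
  exponent \<open>- 1 / 2\<close>. The total \<open>- 1\<close> is \<open>- \<beta> / 2\<close> for
  \<open>\<beta> = 2\<close>.\<close>

lemma (in prob_space) std_normal_complex_mgf_square:
  assumes "std_normal_complex M Z" "s < 1 / 2"
  shows "(\<integral>\<^sup>+\<omega>. ennreal (exp (s * (norm (Z \<omega>))\<^sup>2)) \<partial>M) = ennreal ((1 - 2 * s) powr (- 1))"
proof -
  obtain g1 g2 where g: "std_normal_real M g1" "std_normal_real M g2"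
    "indep_var borel g1 borel g2"
    and Z: "\<And>\<omega>. \<omega> \<in> space M \<Longrightarrow> Re (Z \<omega>) = g1 \<omega>" "\<And>\<omega>. \<omega> \<in> space M \<Longrightarrow> Im (Z \<omega>) = g2 \<omega>"
    using assms(1) by (rule std_normal_complexE) blast
  have "(\<integral>\<^sup>+\<omega>. ennreal (exp (s * (norm (Z \<omega>))\<^sup>2)) \<partial>M) =
      (\<integral>\<^sup>+\<omega>. ennreal (exp (s * (g1 \<omega>)\<^sup>2)) * ennreal (exp (s * (g2 \<omega>)\<^sup>2)) \<partial>M)"
    by (intro nn_integral_cong) (simp add: cmod_power2 Z distrib_left exp_add ennreal_mult')
  also have "\<dots> = (\<integral>\<^sup>+\<omega>. ennreal (exp (s * (g1 \<omega>)\<^sup>2)) \<partial>M) * (\<integral>\<^sup>+\<omega>. ennreal (exp (s * (g2 \<omega>)\<^sup>2)) \<partial>M)"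
    by (rule indep_var_nn_integral_mult[OF g(3)]) measurable
  also have "\<dots> = ennreal ((1 - 2 * s) powr (- 1))"
    using assms(2)
    by (simp add: std_normal_real_mgf_square g ennreal_mult'[symmetric] powr_add[symmetric])
  finally show ?thesis .
qed

section \<open>Matrices with independent entries\<close>

lemma (in prob_space) indep_entries_measurable:
  fixes \<Theta> :: "'a \<Rightarrow> 'f::topological_space^'m^'q"
  assumes "indep_entries M \<Theta>"
  shows "(\<lambda>\<omega>. \<Theta> \<omega> $ i $ j) \<in> borel_measurable M"
  using assms unfolding indep_entries_def indep_vars_def
  by (auto dest!: bspec[where x = "(i, j)"])

lemma (in prob_space) indep_entries_nn_integral:
  fixes \<Theta> :: "'a \<Rightarrow> 'f::topological_space^'m^'q" and f :: "'q \<Rightarrow> 'm \<Rightarrow> 'f \<Rightarrow> ennreal"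
  assumes "indep_entries M \<Theta>" and f: "\<And>i j. f i j \<in> borel_measurable borel"
  shows "(\<integral>\<^sup>+\<omega>. (\<Prod>i\<in>UNIV. \<Prod>j\<in>UNIV. f i j (\<Theta> \<omega> $ i $ j)) \<partial>M) =
    (\<Prod>i\<in>UNIV. \<Prod>j\<in>UNIV. \<integral>\<^sup>+\<omega>. f i j (\<Theta> \<omega> $ i $ j) \<partial>M)"
proof -
  have "indep_vars (\<lambda>_. borel)
      (\<lambda>p \<omega>. f (fst p) (snd p) ((case p of (i, j) \<Rightarrow> \<lambda>\<omega>. \<Theta> \<omega> $ i $ j) \<omega>)) UNIV"
    by (rule indep_vars_compose2[OF assms(1)[unfolded indep_entries_def]]) (rule f)
  then have "(\<integral>\<^sup>+\<omega>. (\<Prod>p\<in>UNIV. f (fst p) (snd p) (\<Theta> \<omega> $ fst p $ snd p)) \<partial>M) =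
      (\<Prod>p\<in>UNIV. \<integral>\<^sup>+\<omega>. f (fst p) (snd p) (\<Theta> \<omega> $ fst p $ snd p) \<partial>M)"
    by (intro indep_vars_nn_integral) (auto simp: case_prod_unfold)
  then show ?thesis
    by (simp add: prod.cartesian_product case_prod_unfold flip: UNIV_Times_UNIV)
qed

text \<open>The exponential of the sum is a product over the entries, which independence integrates
  factor by factor. Normality enters only through \<open>mgf\<close>, so that real and complex
  matrices are treated together.\<close>

lemma (in prob_space) matrix_mgf:
  fixes \<Theta> :: "'a \<Rightarrow> 'f::euclidean_space^'m^'q"
  assumes "indep_entries M \<Theta>"
    and mgf: "\<And>i j a. (\<integral>\<^sup>+\<omega>. ennreal (exp (a \<bullet> \<Theta> \<omega> $ i $ j)) \<partial>M) = ennreal (exp ((norm a)\<^sup>2 / 2))"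
  shows "(\<integral>\<^sup>+\<omega>. ennreal (exp (\<Sum>i\<in>UNIV. \<Sum>j\<in>UNIV. a i j \<bullet> \<Theta> \<omega> $ i $ j)) \<partial>M) =
    ennreal (exp (\<Sum>i\<in>UNIV. \<Sum>j\<in>UNIV. (norm (a i j))\<^sup>2 / 2))"
proof -
  have "(\<integral>\<^sup>+\<omega>. (\<Prod>i\<in>UNIV. \<Prod>j\<in>UNIV. ennreal (exp (a i j \<bullet> \<Theta> \<omega> $ i $ j))) \<partial>M) =
    (\<Prod>i\<in>UNIV. \<Prod>j\<in>UNIV. \<integral>\<^sup>+\<omega>. ennreal (exp (a i j \<bullet> \<Theta> \<omega> $ i $ j)) \<partial>M)"
    by (intro indep_entries_nn_integral[OF assms(1), where f = "\<lambda>i j x. ennreal (exp (a i j \<bullet> x))"])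
      measurable
  then show ?thesis
    by (simp add: mgf exp_sum prod_ennreal prod_nonneg)
qed

text \<open>This replaces rotation invariance: for a unit vector \<open>u\<close>, the squared norm
  of the product has the same exponential moment as that of a single column of
  \<open>\<Theta>\<close>. The parameter \<open>conj\<close> stands for the identity on the reals
  and for \<open>cnj\<close> on the complex numbers.\<close>

lemma (in prob_space) matrix_vector_mgf_square:
  fixes \<Theta> :: "'a \<Rightarrow> 'f::{real_normed_field, euclidean_space}^'m^'q" and u :: "'m \<Rightarrow> 'f"
    and conj :: "'f \<Rightarrow> 'f"
  assumes indep: "indep_entries M \<Theta>"
    and mgf: "\<And>i j a. (\<integral>\<^sup>+\<omega>. ennreal (exp (a \<bullet> \<Theta> \<omega> $ i $ j)) \<partial>M) = ennreal (exp ((norm a)\<^sup>2 / 2))"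
    and sq: "\<And>i j. (\<integral>\<^sup>+\<omega>. ennreal (exp (s * (norm (\<Theta> \<omega> $ i $ j))\<^sup>2)) \<partial>M) = C"
    and conj: "\<And>x y u. x \<bullet> (y * u) = (x * conj u) \<bullet> y" "\<And>u. norm (conj u) = norm u"
    and u: "(\<Sum>j\<in>UNIV. (norm (u j))\<^sup>2) = 1" and s: "s \<ge> 0"
  shows "(\<integral>\<^sup>+\<omega>. ennreal (exp (s * (\<Sum>i\<in>UNIV. (norm (\<Sum>j\<in>UNIV. \<Theta> \<omega> $ i $ j * u j))\<^sup>2))) \<partial>M) =
    C ^ CARD('q)"
proof -
  note [measurable] = indep_entries_measurable[OF indep]
  interpret P: pair_sigma_finite M M ..
  \<comment> \<open>Any fixed column will do: column \<open>j0\<close> of the copy plays the part of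
    the auxiliary normal vector.\<close>
  obtain j0 :: 'm where True by simp
  \<comment> \<open>With this scale, the exponent \<open>(norm (c *\<^sub>R y))\<^sup>2 / 2\<close>
    given by \<open>mgf\<close> becomes \<open>s * (norm y)\<^sup>2\<close>.\<close>
  define c where "c = sqrt (2 * s)"
  have c: "c\<^sup>2 / 2 = s"
    using s by (simp add: c_def)
  define w where "w \<omega> i = (\<Sum>j\<in>UNIV. \<Theta> \<omega> $ i $ j * u j)" for \<omega> i
  have [measurable]: "(\<lambda>\<omega>. w \<omega> i) \<in> borel_measurable M" for i
    unfolding w_def by measurable
  \<comment> \<open>The kernel is linear in each argument inside the exponential. Integrating out
    either one leaves the exponential square of the other: \<open>A\<close> removes the auxiliary
    column, \<open>B\<close> removes the vector \<open>w\<close>.\<close>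
  define F where "F h y = ennreal (exp (\<Sum>i\<in>UNIV. c * (h i \<bullet> y i)))" for h y :: "'q \<Rightarrow> 'f"
  have A: "(\<integral>\<^sup>+\<omega>'. F (\<lambda>i. \<Theta> \<omega>' $ i $ j0) y \<partial>M) = ennreal (exp (s * (\<Sum>i\<in>UNIV. (norm (y i))\<^sup>2)))" for y
  proof -
    define a where "a i j = (if j = j0 then c *\<^sub>R y i else 0)" for i j
    have "(\<Sum>j\<in>UNIV. a i j \<bullet> \<Theta> \<omega> $ i $ j) = c * (\<Theta> \<omega> $ i $ j0 \<bullet> y i)" for \<omega> i
    proof -
      have "a i j \<bullet> \<Theta> \<omega> $ i $ j = (if j = j0 then c * (\<Theta> \<omega> $ i $ j0 \<bullet> y i) else 0)" for j
        by (simp add: a_def inner_commute)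
      then show ?thesis by simp
    qed
    moreover have "(\<Sum>j\<in>UNIV. (norm (a i j))\<^sup>2 / 2) = s * (norm (y i))\<^sup>2" for i
      by (simp add: a_def if_distrib[of "\<lambda>x. (norm x)\<^sup>2 / 2"] power_mult_distrib c[symmetric] cong: if_cong)
    ultimately show ?thesis
      using matrix_mgf[OF indep mgf, of a] by (simp add: F_def sum_distrib_left)
  qed
  have B: "(\<integral>\<^sup>+\<omega>. F h (w \<omega>) \<partial>M) = ennreal (exp (s * (\<Sum>i\<in>UNIV. (norm (h i))\<^sup>2)))" for h
  proof -
    \<comment> \<open>The adjoint moves \<open>u\<close> onto \<open>h\<close>, which exhibits the
      exponent as a real linear form in the entries of \<open>\<Theta>\<close>. Since
      \<open>u\<close> is a unit vector, the coefficients of row \<open>i\<close> have squared norms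
      adding up to \<open>c\<^sup>2 * (norm (h i))\<^sup>2\<close>.\<close>
    define a where "a i j = c *\<^sub>R (h i * conj (u j))" for i j
    have "(\<Sum>j\<in>UNIV. a i j \<bullet> \<Theta> \<omega> $ i $ j) = c * (h i \<bullet> w \<omega> i)" for \<omega> i
      by (simp add: a_def w_def inner_sum_right conj(1) sum_distrib_left)
    moreover have "(\<Sum>j\<in>UNIV. (norm (a i j))\<^sup>2 / 2) = s * (norm (h i))\<^sup>2" for i
    proof -
      have "(\<Sum>j\<in>UNIV. (norm (a i j))\<^sup>2 / 2) = s * (norm (h i))\<^sup>2 * (\<Sum>j\<in>UNIV. (norm (u j))\<^sup>2)"
        by (simp add: a_def norm_mult power_mult_distrib conj(2) c[symmetric] sum_distrib_left mult_ac)
      then show ?thesis by (simp add: u)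
    qed
    ultimately show ?thesis
      using matrix_mgf[OF indep mgf, of a] by (simp add: F_def sum_distrib_left)
  qed
  have "(\<integral>\<^sup>+\<omega>. ennreal (exp (s * (\<Sum>i\<in>UNIV. (norm (w \<omega> i))\<^sup>2))) \<partial>M) =
      (\<integral>\<^sup>+\<omega>. (\<integral>\<^sup>+\<omega>'. F (\<lambda>i. \<Theta> \<omega>' $ i $ j0) (w \<omega>) \<partial>M) \<partial>M)"
    by (simp only: A)
  also have "\<dots> = (\<integral>\<^sup>+\<omega>'. (\<integral>\<^sup>+\<omega>. F (\<lambda>i. \<Theta> \<omega>' $ i $ j0) (w \<omega>) \<partial>M) \<partial>M)"
    \<comment> \<open>The product of \<open>M\<close> with itself supplies the independent copy; the
      integrand is nonnegative, so the exchange requires only measurability.\<close>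
    by (rule P.Fubini'[symmetric]) (unfold F_def, measurable)
  also have "\<dots> = (\<integral>\<^sup>+\<omega>'. ennreal (exp (s * (\<Sum>i\<in>UNIV. (norm (\<Theta> \<omega>' $ i $ j0))\<^sup>2))) \<partial>M)"
    by (simp only: B)
  \<comment> \<open>Padding with factors 1 outside column \<open>j0\<close> gives a product over all
    entries, to which their joint independence applies.\<close>
  also have "\<dots> = (\<integral>\<^sup>+\<omega>'. (\<Prod>i\<in>UNIV. \<Prod>j\<in>UNIV.
      if j = j0 then ennreal (exp (s * (norm (\<Theta> \<omega>' $ i $ j))\<^sup>2)) else 1) \<partial>M)"
    by (simp add: exp_sum sum_distrib_left prod_ennreal)
  also have "\<dots> = (\<Prod>i\<in>UNIV. \<Prod>j\<in>UNIV.
      \<integral>\<^sup>+\<omega>'. (if j = j0 then ennreal (exp (s * (norm (\<Theta> \<omega>' $ i $ j))\<^sup>2)) else 1) \<partial>M)"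
    by (rule indep_entries_nn_integral[OF indep,
          where f = "\<lambda>i j x. if j = j0 then ennreal (exp (s * (norm x)\<^sup>2)) else 1"]) measurable
  also have "\<dots> = (\<Prod>i\<in>(UNIV :: 'q set). \<Prod>j\<in>UNIV. if j = j0 then C else 1)"
    by (intro prod.cong refl) (auto simp: sq emeasure_space_1)
  also have "\<dots> = C ^ CARD('q)"
    by simp
  finally show ?thesis
    by (simp add: w_def)
qed

section \<open>From vectors to matrices\<close>

lemma frobenius_norm_square:
  "(frobenius_norm A)\<^sup>2 = (\<Sum>i\<in>UNIV. \<Sum>j\<in>UNIV. (norm (A $ i $ j))\<^sup>2)"
  by (simp add: frobenius_norm_def sum_nonneg)

text \<open>The columns of \<open>\<Theta> \<omega> ** D\<close> are dependent in general, so their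
  joint moment does not factor. Jensen's inequality leaves a weighted mean of moments of single
  normalised columns, all with the same value.\<close>

lemma (in prob_space) matrix_product_mgf_square_le:
  fixes \<Theta> :: "'a \<Rightarrow> 'f::{real_normed_field, euclidean_space}^'m^'q" and D :: "'f^'n^'m"
    and conj :: "'f \<Rightarrow> 'f"
  assumes indep: "indep_entries M \<Theta>"
    and mgf: "\<And>i j a. (\<integral>\<^sup>+\<omega>. ennreal (exp (a \<bullet> \<Theta> \<omega> $ i $ j)) \<partial>M) = ennreal (exp ((norm a)\<^sup>2 / 2))"
    and sq: "\<And>i j. (\<integral>\<^sup>+\<omega>. ennreal (exp (s * (norm (\<Theta> \<omega> $ i $ j))\<^sup>2)) \<partial>M) = ennreal C"
    and conj: "\<And>x y u. x \<bullet> (y * u) = (x * conj u) \<bullet> y" "\<And>u. norm (conj u) = norm u"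
    and s: "s \<ge> 0" and C: "C \<ge> 0" and D: "D \<noteq> 0"
  shows "(\<integral>\<^sup>+\<omega>. ennreal (exp (s * (frobenius_norm (\<Theta> \<omega> ** D))\<^sup>2 / (frobenius_norm D)\<^sup>2)) \<partial>M) \<le>
    ennreal (C ^ CARD('q))"
proof -
  note [measurable] = indep_entries_measurable[OF indep]
  define N where "N = (frobenius_norm D)\<^sup>2"
  define d where "d k = sqrt (\<Sum>j\<in>UNIV. (norm (D $ j $ k))\<^sup>2)" for k
  have d2: "(d k)\<^sup>2 = (\<Sum>j\<in>UNIV. (norm (D $ j $ k))\<^sup>2)" for k
    by (simp add: d_def sum_nonneg)
  have "N > 0"
    using D by (simp add: N_def frobenius_norm_eq_norm)
  have N: "N = (\<Sum>k\<in>UNIV. (d k)\<^sup>2)"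
    unfolding N_def frobenius_norm_square d2 by (rule sum.swap)
  define p where "p k = (d k)\<^sup>2 / N" for k
  have p0: "p k \<ge> 0" for k
    using \<open>N > 0\<close> by (simp add: p_def)
  have p1: "(\<Sum>k\<in>UNIV. p k) = 1"
    using \<open>N > 0\<close> by (simp add: p_def N flip: sum_divide_distrib)
  \<comment> \<open>For a zero column, division by zero gives \<open>u k j = 0\<close>. The
    factorisation \<open>D_u\<close> then still holds, while \<open>u k\<close> has norm 1 only if
    \<open>d k \<noteq> 0\<close>.\<close>
  define u where "u k j = D $ j $ k / of_real (d k)" for k j
  have u1: "(\<Sum>j\<in>UNIV. (norm (u k j))\<^sup>2) = 1" if "d k \<noteq> 0" for k
    using that by (simp add: u_def norm_divide power_divide d2[symmetric] flip: sum_divide_distrib)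
  define S where "S \<omega> k = (\<Sum>i\<in>UNIV. (norm (\<Sum>j\<in>UNIV. \<Theta> \<omega> $ i $ j * u k j))\<^sup>2)" for \<omega> k
  have [measurable]: "(\<lambda>\<omega>. S \<omega> k) \<in> borel_measurable M" for k
    unfolding S_def by measurable
  have D_u: "D $ j $ k = of_real (d k) * u k j" for j k
  proof (cases "d k = 0")
    case True
    then have "(norm (D $ j $ k))\<^sup>2 = 0"
      using d2[of k] by (simp add: sum_nonneg_eq_0_iff)
    then show ?thesis
      using True by simp
  qed (simp add: u_def)
  have "(frobenius_norm (\<Theta> \<omega> ** D))\<^sup>2 = (\<Sum>k\<in>UNIV. (d k)\<^sup>2 * S \<omega> k)" for \<omega>
  proof -
    have "(norm ((\<Theta> \<omega> ** D) $ i $ k))\<^sup>2 = (d k)\<^sup>2 * (norm (\<Sum>j\<in>UNIV. \<Theta> \<omega> $ i $ j * u k j))\<^sup>2" for i k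
    proof -
      have "(\<Theta> \<omega> ** D) $ i $ k = of_real (d k) * (\<Sum>j\<in>UNIV. \<Theta> \<omega> $ i $ j * u k j)"
        by (simp add: matrix_matrix_mult_def D_u sum_distrib_left mult_ac)
      then show ?thesis
        by (simp add: norm_mult power_mult_distrib)
    qed
    then have "(frobenius_norm (\<Theta> \<omega> ** D))\<^sup>2 =
        (\<Sum>i\<in>UNIV. \<Sum>k\<in>UNIV. (d k)\<^sup>2 * (norm (\<Sum>j\<in>UNIV. \<Theta> \<omega> $ i $ j * u k j))\<^sup>2)"
      by (simp add: frobenius_norm_square)
    also have "\<dots> = (\<Sum>k\<in>UNIV. (d k)\<^sup>2 * S \<omega> k)"
      unfolding S_def sum_distrib_left by (rule sum.swap)
    finally show ?thesis .
  qed
  then have "s * (frobenius_norm (\<Theta> \<omega> ** D))\<^sup>2 / N = (\<Sum>k\<in>UNIV. p k *\<^sub>R (s * S \<omega> k))" for \<omega>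
    by (simp add: p_def sum_distrib_left sum_divide_distrib mult_ac)
  moreover have "exp (\<Sum>k\<in>UNIV. p k *\<^sub>R (s * S \<omega> k)) \<le> (\<Sum>k\<in>UNIV. p k * exp (s * S \<omega> k))" for \<omega>
    by (rule convex_on_sum[OF _ _ exp_convex]) (auto simp: p0 p1)
  ultimately have "(\<integral>\<^sup>+\<omega>. ennreal (exp (s * (frobenius_norm (\<Theta> \<omega> ** D))\<^sup>2 / N)) \<partial>M) \<le>
      (\<integral>\<^sup>+\<omega>. ennreal (\<Sum>k\<in>UNIV. p k * exp (s * S \<omega> k)) \<partial>M)"
    by (intro nn_integral_mono ennreal_leI) simp
  also have "\<dots> = (\<Sum>k\<in>UNIV. ennreal (p k) * (\<integral>\<^sup>+\<omega>. ennreal (exp (s * S \<omega> k)) \<partial>M))"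
    by (simp add: p0 sum_ennreal[symmetric] ennreal_mult' nn_integral_sum nn_integral_cmult
        del: sum_ennreal)
  also have "\<dots> = (\<Sum>k\<in>UNIV. ennreal (p k) * ennreal (C ^ CARD('q)))"
  proof (rule sum.cong[OF refl])
    fix k
    show "ennreal (p k) * (\<integral>\<^sup>+\<omega>. ennreal (exp (s * S \<omega> k)) \<partial>M) =
        ennreal (p k) * ennreal (C ^ CARD('q))"
    \<comment> \<open>A zero column has weight \<open>p k = 0\<close>, so both sides vanish whatever
      the integral is.\<close>
    proof (cases "d k = 0")
      case True
      then show ?thesis by (simp add: p_def)
    next
      case False
      then show ?thesis
        using matrix_vector_mgf_square[OF indep mgf sq conj u1 s] C
        by (simp add: S_def ennreal_power)
    qed
  qed
  also have "\<dots> = ennreal (C ^ CARD('q))"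
    by (simp add: p0 p1 flip: sum_distrib_right)
  finally show ?thesis
    by (simp add: N_def)
qed

section \<open>The tail bound\<close>

lemma (in prob_space) err_sq_tail_bound:
  fixes \<Theta> :: "'a \<Rightarrow> 'f::{real_normed_field, euclidean_space}^'m^'q" and A B :: "'f^'n^'m"
    and conj :: "'f \<Rightarrow> 'f"
  assumes indep: "indep_entries M \<Theta>"
    and mgf: "\<And>i j a. (\<integral>\<^sup>+\<omega>. ennreal (exp (a \<bullet> \<Theta> \<omega> $ i $ j)) \<partial>M) = ennreal (exp ((norm a)\<^sup>2 / 2))"
    and sq: "\<And>i j s. s < 1 / 2 \<Longrightarrow> (\<integral>\<^sup>+\<omega>. ennreal (exp (s * (norm (\<Theta> \<omega> $ i $ j))\<^sup>2)) \<partial>M) =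
      ennreal ((1 - 2 * s) powr (- \<beta> / 2))"
    and conj: "\<And>x y u. x \<bullet> (y * u) = (x * conj u) \<bullet> y" "\<And>u. norm (conj u) = norm u"
    and \<beta>: "\<beta> > 0" and \<epsilon>: "\<epsilon> > 0" and AB: "A \<noteq> B"
  shows "\<P>(\<omega> in M. err_sq \<beta> (\<Theta> \<omega> ** A) (\<Theta> \<omega>) B \<ge> (1 + \<epsilon>) * (frobenius_norm (A - B))\<^sup>2)
    \<le> (exp \<epsilon> / (1 + \<epsilon>)) powr (- (\<beta> * real CARD('q) / 2))"
proof -
  note [measurable] = indep_entries_measurable[OF indep]
  define D where "D = A - B"
  define N where "N = (frobenius_norm D)\<^sup>2"
  \<comment> \<open>This \<open>s\<close> minimises \<open>exp (- s * (1 + \<epsilon>) * b) * (1 - 2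
    * s) powr (- b / 2)\<close>: the derivative of the logarithm vanishes when
    \<open>1 - 2 * s = 1 / (1 + \<epsilon>)\<close>.\<close>
  define s where "s = \<epsilon> / (2 * (1 + \<epsilon>))"
  define b where "b = \<beta> * real CARD('q)"
  define C where "C = (1 - 2 * s) powr (- \<beta> / 2)"
  define Y where "Y \<omega> = exp (s * (frobenius_norm (\<Theta> \<omega> ** D))\<^sup>2 / N)" for \<omega>
  have s: "s \<ge> 0" "s < 1 / 2" "1 - 2 * s = 1 / (1 + \<epsilon>)"
    using \<epsilon> by (auto simp: s_def field_simps)
  have "D \<noteq> 0"
    using AB by (simp add: D_def)
  then have "N > 0"
    by (simp add: N_def frobenius_norm_eq_norm)
  have "b > 0"
    using \<beta> by (simp add: b_def)
  have [measurable]: "Y \<in> borel_measurable M"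
    unfolding Y_def frobenius_norm_square matrix_matrix_mult_def by simp
  \<comment> \<open>The event is put into the form required by Markov's inequality: divide by
    \<open>N > 0\<close>, multiply by \<open>s > 0\<close> and exponentiate. The threshold becomes
    \<open>s * (1 + \<epsilon>) * b = \<epsilon> * b / 2\<close>.\<close>
  have ev: "err_sq \<beta> (\<Theta> \<omega> ** A) (\<Theta> \<omega>) B \<ge> (1 + \<epsilon>) * N \<longleftrightarrow> 1 \<le> exp (- (\<epsilon> * b / 2)) * Y \<omega>" for \<omega>
  proof -
    define F where "F = (frobenius_norm (\<Theta> \<omega> ** D))\<^sup>2"
    have "s * ((1 + \<epsilon>) * b) = \<epsilon> * b / 2"
      using \<epsilon> by (simp add: s_def field_simps)
    have "(1 + \<epsilon>) * N \<le> err_sq \<beta> (\<Theta> \<omega> ** A) (\<Theta> \<omega>) B \<longleftrightarrow> (1 + \<epsilon>) * b \<le> F / N"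
      unfolding err_sq_sketch D_def[symmetric] b_def[symmetric] F_def[symmetric]
      using \<open>N > 0\<close> \<open>b > 0\<close> by (simp add: field_simps)
    also have "\<dots> \<longleftrightarrow> s * ((1 + \<epsilon>) * b) \<le> s * (F / N)"
      using \<epsilon> by (subst mult_le_cancel_left_pos) (auto simp: s_def)
    also have "\<dots> \<longleftrightarrow> 0 \<le> - (\<epsilon> * b / 2) + s * F / N"
      unfolding \<open>s * ((1 + \<epsilon>) * b) = \<epsilon> * b / 2\<close> by auto
    also have "\<dots> \<longleftrightarrow> 1 \<le> exp (- (\<epsilon> * b / 2)) * Y \<omega>"
      by (simp only: Y_def F_def exp_add[symmetric] one_le_exp_iff)
    finally show ?thesis .
  qed
  have "emeasure M {\<omega> \<in> space M. 1 \<le> exp (- (\<epsilon> * b / 2)) * Y \<omega>} =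
      emeasure M {\<omega> \<in> space M. 1 \<le> ennreal (exp (- (\<epsilon> * b / 2))) * ennreal (Y \<omega>)}"
    by (simp add: ennreal_mult'[symmetric])
  also have "\<dots> \<le> ennreal (exp (- (\<epsilon> * b / 2))) *
      (\<integral>\<^sup>+\<omega>. ennreal (Y \<omega>) * indicator (space M) \<omega> \<partial>M)"
    by (rule nn_integral_Markov_inequality) auto
  also have "(\<integral>\<^sup>+\<omega>. ennreal (Y \<omega>) * indicator (space M) \<omega> \<partial>M) = (\<integral>\<^sup>+\<omega>. ennreal (Y \<omega>) \<partial>M)"
    by (intro nn_integral_cong) simp
  also have "ennreal (exp (- (\<epsilon> * b / 2))) * \<dots> \<le>
      ennreal (exp (- (\<epsilon> * b / 2))) * ennreal (C ^ CARD('q))"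
    unfolding Y_def N_def
    by (intro mult_left_mono matrix_product_mgf_square_le[OF indep mgf _ conj])
      (simp_all add: sq[OF s(2)] s(1) C_def \<open>D \<noteq> 0\<close>)
  also have "\<dots> = ennreal (exp (- (\<epsilon> * b / 2)) * C ^ CARD('q))"
    by (simp add: ennreal_mult')
  \<comment> \<open>By the choice of \<open>s\<close>, \<open>C ^ CARD('q)\<close> is
    \<open>(1 + \<epsilon>) powr (b / 2)\<close>, which combines with the Markov factor into a
    single power.\<close>
  also have "exp (- (\<epsilon> * b / 2)) * C ^ CARD('q) = (exp \<epsilon> / (1 + \<epsilon>)) powr (- (b / 2))"
  proof -
    have "C > 0"
      using \<epsilon> by (simp add: C_def s(3))
    have "C ^ CARD('q) = exp (b / 2 * ln (1 + \<epsilon>))"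
      using \<epsilon> \<open>C > 0\<close> by (simp add: C_def s(3) b_def powr_def ln_div exp_of_nat_mult[symmetric])
    then show ?thesis
      using \<epsilon> by (simp add: powr_def ln_div exp_add[symmetric] algebra_simps)
  qed
  finally have "\<P>(\<omega> in M. 1 \<le> exp (- (\<epsilon> * b / 2)) * Y \<omega>) \<le> (exp \<epsilon> / (1 + \<epsilon>)) powr (- (b / 2))"
    by (simp add: emeasure_eq_measure)
  then show ?thesis
    by (simp add: ev b_def flip: N_def D_def)
qed

text \<open>Independence of the approximation from the sketch is expressed by taking
  \<open>Aout\<close> to be a constant matrix. For \<open>A = Aout\<close> both sides of the
  inequality inside the event are 0, so its probability is 1, whereas the bound is below 1; this
  degenerate case has to be excluded.\<close>

theorem mainTheorem5:
  fixes M :: "'a measure" and \<epsilon> :: real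
  assumes "prob_space M" and "\<epsilon> > 0"
  shows
    "(\<forall>(\<Theta> :: 'a \<Rightarrow> real^'m^'q) (A :: real^'n^'m) (Aout :: real^'n^'m) (\<beta> :: real).
        \<beta> = 1 \<and> std_normal_matrix_real M \<Theta> \<and> A \<noteq> Aout \<longrightarrow>
        \<P>(\<omega> in M. err_sq \<beta> (\<Theta> \<omega> ** A) (\<Theta> \<omega>) Aout
                    \<ge> (1 + \<epsilon>) * (frobenius_norm (A - Aout))\<^sup>2)
          \<le> (exp \<epsilon> / (1 + \<epsilon>)) powr (- (\<beta> * real CARD('q) / 2)))
     \<and>
     (\<forall>(\<Theta> :: 'a \<Rightarrow> complex^'m^'q) (A :: complex^'n^'m) (Aout :: complex^'n^'m) (\<beta> :: real).
        \<beta> = 2 \<and> std_normal_matrix_complex M \<Theta> \<and> A \<noteq> Aout \<longrightarrow>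
        \<P>(\<omega> in M. err_sq \<beta> (\<Theta> \<omega> ** A) (\<Theta> \<omega>) Aout
                    \<ge> (1 + \<epsilon>) * (frobenius_norm (A - Aout))\<^sup>2)
          \<le> (exp \<epsilon> / (1 + \<epsilon>)) powr (- (\<beta> * real CARD('q) / 2)))"
proof (intro conjI allI impI; elim conjE)
  interpret prob_space M by fact
  {
    fix \<Theta> :: "'a \<Rightarrow> real^'m^'q" and A Aout :: "real^'n^'m" and \<beta> :: real
    assume "\<beta> = 1" "std_normal_matrix_real M \<Theta>" "A \<noteq> Aout"
    then show "\<P>(\<omega> in M. err_sq \<beta> (\<Theta> \<omega> ** A) (\<Theta> \<omega>) Aout
                    \<ge> (1 + \<epsilon>) * (frobenius_norm (A - Aout))\<^sup>2)
          \<le> (exp \<epsilon> / (1 + \<epsilon>)) powr (- (\<beta> * real CARD('q) / 2))"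
      using \<open>\<epsilon> > 0\<close>
      \<comment> \<open>Multiplication by a real number is self-adjoint, so \<open>conj\<close> is
        the identity; in the complex case below it is \<open>cnj\<close>.\<close>
      by (intro err_sq_tail_bound[where conj = "\<lambda>x. x"])
        (auto simp: std_normal_matrix_real_def std_normal_real_mgf std_normal_real_mgf_square)
  next
    fix \<Theta> :: "'a \<Rightarrow> complex^'m^'q" and A Aout :: "complex^'n^'m" and \<beta> :: real
    assume "\<beta> = 2" "std_normal_matrix_complex M \<Theta>" "A \<noteq> Aout"
    then show "\<P>(\<omega> in M. err_sq \<beta> (\<Theta> \<omega> ** A) (\<Theta> \<omega>) Aout
                    \<ge> (1 + \<epsilon>) * (frobenius_norm (A - Aout))\<^sup>2)
          \<le> (exp \<epsilon> / (1 + \<epsilon>)) powr (- (\<beta> * real CARD('q) / 2))"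
      using \<open>\<epsilon> > 0\<close>
      by (intro err_sq_tail_bound[where conj = cnj])
        (auto simp: std_normal_matrix_complex_def std_normal_complex_mgf
          std_normal_complex_mgf_square inner_mult_complex)
  }
qed

end
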